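(* Let $a,b$ be coprime positive integers with $b>a$, and let $\gamma_{a,b}(t)=\exp(2\pi i a t)+\exp(2\pi i b t)$. If $a=1$, then the symmetry group of the image of $\gamma_{a,b}$ is $D_{b-1}$. Otherwise, the symmetry group of the image of $\gamma_{a,b}$ is $D_{b-a}$.
   Context: The image of $\gamma_{a,b}$ is the set $\{\gamma_{a,b}(t): t\in[0,1]\}\subset\mathbb{C}\cong\mathbb{R}^2$. The symmetry group of a set $X\subset\mathbb{R}^2$ is the group, under composition, of all isometries of the plane that leave $X$ invariant (map $X$ onto $X$). The dihedral group $D_n$ is the group with $2n$ elements consisting of the rotations about a fixed point by multiples of the angle $2\pi/n$, together with the reflections in $n$ axes that all pass through this fixed point. *)

theory Defs
  imports "HOL-Analysis.Analysis" "HOL-Algebra.Group"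
begin

definition two_circles_curve :: "nat \<Rightarrow> nat \<Rightarrow> real \<Rightarrow> complex"  (\<open>\<gamma>\<close>)
  where "\<gamma> a b t = exp (2 * of_real pi * \<i> * of_nat a * of_real t) +
                   exp (2 * of_real pi * \<i> * of_nat b * of_real t)"

definition plane_isometry_group :: "(complex \<Rightarrow> complex) monoid"
  where "plane_isometry_group =
    \<lparr>carrier = {f. bij f \<and> (\<forall>z w. dist (f z) (f w) = dist z w)}, mult = (\<circ>), one = id\<rparr>"

definition symmetry_group :: "complex set \<Rightarrow> (complex \<Rightarrow> complex) set"
  where "symmetry_group X = {f \<in> carrier plane_isometry_group. f ` X = X}"

definition rotation_about :: "complex \<Rightarrow> real \<Rightarrow> complex \<Rightarrow> complex"
  where "rotation_about p \<theta> z = p + cis \<theta> * (z - p)"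

text \<open>Reflection in the line through \<open>p\<close> with direction \<open>cis \<phi>\<close>; see
  \<open>reflection_fixed_points\<close> below.\<close>

definition reflection_about :: "complex \<Rightarrow> real \<Rightarrow> complex \<Rightarrow> complex"
  where "reflection_about p \<phi> z = p + cis (2 * \<phi>) * cnj (z - p)"

text \<open>Each line through \<open>p\<close> has exactly one direction angle in \<open>{0..<pi}\<close>, so a set of \<open>n\<close> axes
  through \<open>p\<close> is given by a set \<open>\<Phi>\<close> of \<open>n\<close> such angles. The centre and the position of the axes
  are not prescribed.\<close>

definition is_dihedral :: "nat \<Rightarrow> (complex \<Rightarrow> complex) set \<Rightarrow> bool"
  where "is_dihedral n D \<longleftrightarrow>
    0 < n \<and> subgroup D plane_isometry_group \<and> card D = 2 * n \<and>
    (\<exists>p \<Phi>. \<Phi> \<subseteq> {0..<pi} \<and> finite \<Phi> \<and> card \<Phi> = n \<and>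
       D = {rotation_about p (of_int k * (2 * pi / of_nat n)) |k :: int. True} \<union>
           reflection_about p ` \<Phi>)"

lemma reflection_fixed_points:
  "{z. reflection_about p \<phi> z = z} = {p + of_real s * cis \<phi> |s. True}"
proof (intro Set.set_eqI iffI)
  fix z assume "z \<in> {z. reflection_about p \<phi> z = z}"
  then have eq: "cis (2 * \<phi>) * cnj (z - p) = z - p"
    by (simp add: reflection_about_def algebra_simps)
  define w where "w = cis (- \<phi>) * (z - p)"
  have "w = cis (- \<phi>) * (cis (2 * \<phi>) * cnj (z - p))"
    unfolding w_def by (simp only: eq)
  also have "\<dots> = cis \<phi> * cnj (z - p)"
    by (simp add: cis_mult flip: mult.assoc)
  also have "\<dots> = cnj w"
    by (simp add: w_def cis_cnj)
  finally have "w \<in> \<real>"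
    by (simp add: Reals_cnj_iff)
  then obtain s where "w = of_real s"
    by (auto elim: Reals_cases)
  moreover have "cis \<phi> * w = z - p"
    by (simp add: w_def cis_mult flip: mult.assoc)
  then have "z = p + w * cis \<phi>"
    by (simp add: mult.commute)
  ultimately show "z \<in> {p + of_real s * cis \<phi> |s. True}" by blast
next
  fix z assume "z \<in> {p + of_real s * cis \<phi> |s. True}"
  then show "z \<in> {z. reflection_about p \<phi> z = z}"
    by (auto simp: reflection_about_def cis_cnj cis_mult mult.left_commute)
qed

lemma group_plane_isometry_group: "group plane_isometry_group"
proof (rule groupI)
  fix f assume f: "f \<in> carrier plane_isometry_group"
  then have "bij f" by (simp add: plane_isometry_group_def)
  then have "dist (inv_into UNIV f z) (inv_into UNIV f w) = dist z w" for z w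
  proof -
    have "dist (f (inv_into UNIV f z)) (f (inv_into UNIV f w)) =
        dist (inv_into UNIV f z) (inv_into UNIV f w)"
      using f by (simp add: plane_isometry_group_def)
    then show ?thesis
      using \<open>bij f\<close> by (simp add: bij_is_surj surj_f_inv_f)
  qed
  then show "\<exists>g\<in>carrier plane_isometry_group. g \<otimes>\<^bsub>plane_isometry_group\<^esub> f = \<one>\<^bsub>plane_isometry_group\<^esub>"
    using \<open>bij f\<close> by (intro bexI[of _ "inv_into UNIV f"])
      (auto simp: plane_isometry_group_def bij_imp_bij_inv bij_is_inj)
qed (auto simp: plane_isometry_group_def bij_comp comp_assoc)

lemma subgroup_symmetry_group: "subgroup (symmetry_group X) plane_isometry_group"
proof (rule group.subgroupI[OF group_plane_isometry_group])
  show "symmetry_group X \<subseteq> carrier plane_isometry_group"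
    by (auto simp: symmetry_group_def)
  show "symmetry_group X \<noteq> {}"
    using monoid.one_closed[OF group.is_monoid[OF group_plane_isometry_group]]
    by (auto simp: symmetry_group_def plane_isometry_group_def intro!: exI[of _ id])
next
  fix f assume f: "f \<in> symmetry_group X"
  let ?g = "inv\<^bsub>plane_isometry_group\<^esub> f"
  have fc: "f \<in> carrier plane_isometry_group" and fX: "f ` X = X"
    using f by (auto simp: symmetry_group_def)
  have "?g \<circ> f = id"
    using group.l_inv[OF group_plane_isometry_group fc] by (simp add: plane_isometry_group_def)
  then have "?g ` X = X"
    by (metis fX image_comp image_id id_apply)
  then show "?g \<in> symmetry_group X"
    using group.inv_closed[OF group_plane_isometry_group fc] by (simp add: symmetry_group_def)
next
  fix f g assume fg: "f \<in> symmetry_group X" "g \<in> symmetry_group X"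
  then have "(f \<circ> g) ` X = X"
    unfolding symmetry_group_def mem_Collect_eq by (metis image_comp)
  with fg show "f \<otimes>\<^bsub>plane_isometry_group\<^esub> g \<in> symmetry_group X"
    by (auto simp: symmetry_group_def plane_isometry_group_def bij_comp)
qed

end

theory Submission
  imports Defs "HOL-Number_Theory.Cong"
begin

text \<open>Put \<open>n = b - a\<close>. Since \<open>cmod (z ^ a + z ^ b) = cmod (1 + z ^ n)\<close> on the unit circle, the image
  lies in the disc of radius 2 about 0 and touches its boundary exactly at the points \<open>2 * c\<close> with
  \<open>c ^ n = 1\<close>; hence only the \<open>2 * n\<close> evident symmetries fix 0. It remains to see that
  every symmetry \<open>f\<close> fixes 0. For \<open>n \<ge> 2\<close>, all \<open>2 * c\<close> are within distance 2 of \<open>f 0\<close>; summing the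
  squared distances and using that the \<open>c\<close> add up to 0 gives \<open>f 0 = 0\<close>. For \<open>n = 1\<close>, the image
  satisfies \<open>S (w * cnj w - 2) = w + cnj w\<close> for a polynomial \<open>S\<close> of degree \<open>b\<close>. Substituting
  \<open>w = c * (z ^ a + z ^ b) + d\<close> yields an identity of Laurent polynomials in \<open>z\<close>, whose terms of
  lowest order force \<open>d = 0\<close>.\<close>

section \<open>Isometries of the complex plane\<close>

text \<open>After normalising to a map \<open>g\<close> that fixes 0 and 1, the distances to these
  two points determine the real part of \<open>g z\<close>, and its imaginary part up to
  sign.\<close>

lemma plane_isometry_cases:
  fixes f :: "complex \<Rightarrow> complex"
  assumes f: "\<And>z w. dist (f z) (f w) = dist z w"
  obtains c where "norm c = 1" "\<And>z. f z = c * z + f 0"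
  | c where "norm c = 1" "\<And>z. f z = c * cnj z + f 0"
proof -
  define c where "c = f 1 - f 0"
  have c: "norm c = 1"
    using f[of 1 0] by (simp add: c_def dist_norm)
  then have c0: "c \<noteq> 0" by auto
  define g where "g z = (f z - f 0) / c" for z
  have fg: "f z = c * g z + f 0" for z
    using c0 by (simp add: g_def)
  have g: "norm (g z - g w) = norm (z - w)" for z w
  proof -
    have "g z - g w = (f z - f w) / c"
      by (simp add: g_def diff_divide_distrib)
    then show ?thesis
      using f[of z w] c by (simp add: dist_norm norm_divide)
  qed
  have g0: "g 0 = 0" and g1: "g 1 = 1"
    using c0 by (simp_all add: g_def c_def)
  have sq: "(Re (g z) - Re (g w))\<^sup>2 + (Im (g z) - Im (g w))\<^sup>2 =
      (Re z - Re w)\<^sup>2 + (Im z - Im w)\<^sup>2" for z w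
    using arg_cong[OF g[of z w], of "\<lambda>x. x\<^sup>2"] by (simp add: cmod_power2)
  have Re: "Re (g z) = Re z" for z
    using sq[of z 0] sq[of z 1] by (simp add: g0 g1 power2_eq_square algebra_simps)
  have Im: "(Im (g z))\<^sup>2 = (Im z)\<^sup>2" for z
    using sq[of z 0] by (simp add: g0 Re)
  \<comment> \<open>Comparing distances to the imaginary unit shows that the sign is the same for
    all \<open>z\<close>.\<close>
  have mixed: "Im (g z) * Im (g \<i>) = Im z" for z
    using sq[of z \<i>] Im[of z] Im[of \<i>] by (simp add: Re power2_diff)
  have "Im (g \<i>) = 1 \<or> Im (g \<i>) = -1"
    using Im[of \<i>] by (simp add: power2_eq_1_iff)
  then show thesis
  proof
    assume "Im (g \<i>) = 1"
    then have "g z = z" for z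
      using Re[of z] mixed[of z] by (simp add: complex_eq_iff)
    then show thesis by (intro that(1)[OF c]) (metis fg)
  next
    assume "Im (g \<i>) = -1"
    then have "g z = cnj z" for z
      using Re[of z] mixed[of z] by (simp add: complex_eq_iff)
    then show thesis by (intro that(2)[OF c]) (metis fg)
  qed
qed

section \<open>Roots of unity, Dickson polynomials and polynomial identities\<close>

lemma root_unity_norm:
  fixes z :: complex
  assumes "0 < n" "z ^ n = 1"
  shows "norm z = 1"
  using assms by (metis power_eq_1_iff not_gr_zero)

lemma infinite_unit_circle: "infinite (sphere (0::complex) 1)"
proof
  assume fin: "finite (sphere (0::complex) 1)"
  \<comment> \<open>One more than the supposed size: the \<open>n\<close> roots of unity of order
    dividing \<open>n\<close> do not fit.\<close>
  define n where "n = Suc (card (sphere (0::complex) 1))"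
  have "{z::complex. z ^ n = 1} \<subseteq> sphere 0 1"
    using root_unity_norm[of n] by (auto simp: n_def)
  then have "n \<le> card (sphere (0::complex) 1)"
    using card_mono[OF fin] card_roots_unity_eq[of n] by (metis n_def zero_less_Suc)
  then show False by (simp add: n_def)
qed

text \<open>Allows an identity known only on the circle to be evaluated at 0.\<close>

lemma poly_eq_of_eq_on_unit_circle:
  fixes P Q :: "complex poly"
  assumes "\<And>z. norm z = 1 \<Longrightarrow> poly P z = poly Q z"
  shows "P = Q"
proof (rule ccontr)
  assume "P \<noteq> Q"
  then have "finite {z. poly (P - Q) z = 0}"
    by (intro poly_roots_finite) simp
  moreover have "sphere 0 1 \<subseteq> {z. poly (P - Q) z = 0}"
    using assms by auto
  ultimately show False
    using infinite_unit_circle finite_subset by blast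
qed

text \<open>Dickson polynomials of the first kind with parameter 1; unlike the Chebyshev polynomials they are
  monic for positive index.\<close>

fun dickson_poly :: "nat \<Rightarrow> complex poly" where
  "dickson_poly 0 = [:2:]"
| "dickson_poly (Suc 0) = [:0, 1:]"
| "dickson_poly (Suc (Suc k)) = [:0, 1:] * dickson_poly (Suc k) - dickson_poly k"

lemma poly_dickson_poly:
  assumes "x \<noteq> 0"
  shows "poly (dickson_poly k) (x + inverse x) = x ^ k + inverse x ^ k"
proof (induction k rule: dickson_poly.induct)
  case (3 k)
  \<comment> \<open>The defect is kept as a multiple of \<open>x * inverse x - 1\<close>, so that
    this is a pure ring identity.\<close>
  have "(x + inverse x) * (x ^ Suc k + inverse x ^ Suc k) - (x ^ k + inverse x ^ k) =
      x ^ Suc (Suc k) + inverse x ^ Suc (Suc k) + (x * inverse x - 1) * (x ^ k + inverse x ^ k)"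
    unfolding power_Suc by (simp only: algebra_simps mult_1_left)
  then have "(x + inverse x) * (x ^ Suc k + inverse x ^ Suc k) - (x ^ k + inverse x ^ k) =
      x ^ Suc (Suc k) + inverse x ^ Suc (Suc k)"
    using assms by simp
  with 3 show ?case by simp
qed simp_all

lemma degree_dickson_poly: "degree (dickson_poly k) \<le> k"
proof (induction k rule: dickson_poly.induct)
  case (3 k)
  have "degree ([:0, 1:] * dickson_poly (Suc k)) \<le> Suc (Suc k)"
    using 3(1) by (intro order.trans[OF degree_mult_le]) simp
  with 3(2) show ?case
    by (simp only: dickson_poly.simps) (rule degree_diff_le, simp_all)
qed simp_all

lemma coeff_dickson_poly: "coeff (dickson_poly (Suc k)) (Suc k) = 1"
proof (induction k)
  case (Suc k)
  have "coeff (dickson_poly k) (Suc (Suc k)) = 0"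
    using degree_dickson_poly[of k] by (intro coeff_eq_0) simp
  with Suc show ?case by simp
qed simp

text \<open>Multiplying by \<open>z ^ (m * N)\<close> turns the term of index \<open>i\<close> into
  \<open>A ^ i\<close> times \<open>z ^ (m * (N - i))\<close>. At 0 only the term with
  \<open>i = N\<close> survives, which exposes the top coefficient of \<open>S\<close>.\<close>

lemma clear_denominators:
  fixes S A :: "complex poly"
  assumes "degree S \<le> N"
  obtains H where "\<And>z. z \<noteq> 0 \<Longrightarrow> poly H z = z ^ (m * N) * poly S (poly A z / z ^ m)"
    "0 < m \<Longrightarrow> poly H 0 = coeff S N * poly A 0 ^ N"
proof
  let ?H = "\<Sum>i\<le>N. smult (coeff S i) (A ^ i * monom 1 (m * (N - i)))"
  have S: "poly S x = (\<Sum>i\<le>N. coeff S i * x ^ i)" for x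
    using arg_cong[OF poly_as_sum_of_monoms'[OF assms], of "\<lambda>p. poly p x"]
    by (simp add: poly_sum poly_monom)
  show "poly ?H z = z ^ (m * N) * poly S (poly A z / z ^ m)" if "z \<noteq> 0" for z
  proof -
    have "z ^ (m * (N - i)) = z ^ (m * N) / (z ^ m) ^ i" if "i \<le> N" for i
      using \<open>z \<noteq> 0\<close> that by (simp add: power_diff diff_mult_distrib2 flip: power_mult)
    then show ?thesis
      by (simp add: S poly_sum poly_monom sum_distrib_left power_divide mult_ac)
  qed
  show "poly ?H 0 = coeff S N * poly A 0 ^ N" if "0 < m"
  proof -
    have "poly ?H 0 = (\<Sum>i\<le>N. if i = N then coeff S N * poly A 0 ^ N else 0)"
      unfolding poly_sum using that by (intro sum.cong) (auto simp: poly_monom)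
    then show ?thesis by simp
  qed
qed

section \<open>The image of the curve and its evident symmetries\<close>

definition two_circles_image :: "nat \<Rightarrow> nat \<Rightarrow> complex set"
  where "two_circles_image a b = (\<lambda>z. z ^ a + z ^ b) ` sphere 0 1"

lemma image_two_circles_curve: "\<gamma> a b ` {0..1} = two_circles_image a b"
proof -
  have "exp (2 * of_real pi * \<i> * of_nat n * of_real t) = cis (2 * pi * t) ^ n" for n t
    unfolding Complex.DeMoivre unfolding cis_conv_exp by (simp add: mult_ac)
  then have eq: "\<gamma> a b t = cis (2 * pi * t) ^ a + cis (2 * pi * t) ^ b" for t
    by (simp add: two_circles_curve_def)
  have "sphere (0::complex) 1 = (\<lambda>t. cis (2 * pi * t)) ` {0..1}"
  proof (intro equalityI subsetI)
    fix z :: complex assume "z \<in> sphere 0 1"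
    then have z: "z = cis (Arg2pi z)"
      using complex_norm_eq_1_exp[of z] by (simp add: cis_conv_exp)
    show "z \<in> (\<lambda>t. cis (2 * pi * t)) ` {0..1}"
    proof (rule image_eqI)
      show "z = cis (2 * pi * (Arg2pi z / (2 * pi)))"
        using z by simp
      show "Arg2pi z / (2 * pi) \<in> {0..1}"
        using Arg2pi_ge_0[of z] Arg2pi_lt_2pi[of z] by (simp add: field_simps)
    qed
  qed auto
  then show ?thesis
    unfolding two_circles_image_def by (simp add: eq image_image)
qed

lemma two_circles_image_cnj:
  assumes "w \<in> two_circles_image a b"
  shows "cnj w \<in> two_circles_image a b"
proof -
  from assms obtain z where z: "norm z = 1" "w = z ^ a + z ^ b"
    by (auto simp: two_circles_image_def)
  then show ?thesis
    unfolding two_circles_image_def by (intro image_eqI[of _ _ "cnj z"]) simp_all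
qed

text \<open>If \<open>u\<close> inverts \<open>a\<close> modulo \<open>b - a\<close>, then
  \<open>c ^ u\<close> has both \<open>a\<close>-th and \<open>b\<close>-th power \<open>c\<close>,
  so replacing \<open>z\<close> by \<open>c ^ u * z\<close> multiplies the curve point by
  \<open>c\<close>.\<close>

lemma two_circles_image_root_unity:
  assumes "coprime a b" "a < b" "c ^ (b - a) = 1" "w \<in> two_circles_image a b"
  shows "c * w \<in> two_circles_image a b"
proof -
  from assms(4) obtain z where z: "norm z = 1" "w = z ^ a + z ^ b"
    by (auto simp: two_circles_image_def)
  have "coprime a (b - a)"
    using assms(1,2) by (metis coprime_iff_gcd_eq_1 gcd.commute gcd_diff1_nat less_imp_le)
  then obtain u where "[a * u = Suc 0] (mod (b - a))"
    using cong_solve_coprime_nat by blast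
  moreover have red: "c ^ k = c ^ (k mod (b - a))" for k
  proof -
    have "c ^ k = c ^ ((b - a) * (k div (b - a)) + k mod (b - a))" by simp
    also have "\<dots> = c ^ (k mod (b - a))"
      by (simp only: power_add power_mult assms(3)) simp
    finally show ?thesis .
  qed
  ultimately have a: "(c ^ u) ^ a = c"
    by (metis cong_def mult.commute power_mult power_one_right One_nat_def)
  have "(c ^ u) ^ (b - a) = 1"
    by (metis assms(3) mult.commute power_mult power_one)
  then have b: "(c ^ u) ^ b = c"
    using a assms(2) by (metis less_imp_le le_add_diff_inverse mult.right_neutral power_add)
  have "norm c = 1"
    using root_unity_norm[of "b - a" c] assms(2,3) by simp
  then show ?thesis
    unfolding two_circles_image_def
    by (intro image_eqI[of _ _ "c ^ u * z"])
      (simp_all add: z norm_mult norm_power power_mult_distrib a b distrib_left)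
qed

lemma two_circles_image_norm_le:
  assumes "w \<in> two_circles_image a b"
  shows "norm w \<le> 2"
proof -
  from assms obtain z where z: "norm z = 1" "w = z ^ a + z ^ b"
    by (auto simp: two_circles_image_def)
  then show ?thesis
    using norm_triangle_ineq[of "z ^ a" "z ^ b"] by (simp add: norm_power)
qed

text \<open>Modulus 2 is the equality case of the triangle inequality for \<open>1 + u\<close> with
  \<open>u = z ^ (b - a)\<close>. It forces \<open>u = 1\<close>, hence
  \<open>c = z ^ a\<close>.\<close>

lemma two_circles_image_double_unit:
  assumes "a < b" "2 * c \<in> two_circles_image a b" "norm c = 1"
  shows "c ^ (b - a) = 1"
proof -
  from assms obtain z where z: "norm z = 1" "2 * c = z ^ a + z ^ b"
    by (auto simp: two_circles_image_def)
  define u where "u = z ^ (b - a)"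
  have zb: "z ^ b = z ^ a * u"
    using assms(1) by (simp add: u_def flip: power_add)
  have u: "norm u = 1"
    using z by (simp add: u_def norm_power)
  have "2 * c = z ^ a * (1 + u)"
    using z zb by (simp add: distrib_left)
  then have "norm (2 * c) = norm (z ^ a) * norm (1 + u)"
    by (simp only: norm_mult)
  then have u2: "norm (1 + u) = 2"
    using assms(3) z(1) by (simp add: norm_mult norm_power)
  have "(1 + Re u)\<^sup>2 + (Im u)\<^sup>2 = 4" "(Re u)\<^sup>2 + (Im u)\<^sup>2 = 1"
    using arg_cong[OF u2, of "\<lambda>x. x\<^sup>2"] arg_cong[OF u, of "\<lambda>x. x\<^sup>2"]
    by (simp_all add: cmod_power2)
  moreover from this have "Re u = 1"
    by (simp add: power2_sum)
  ultimately have "u = 1"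
    by (simp add: complex_eq_iff)
  then have "c = z ^ a"
    using z zb by simp
  then show ?thesis
    using \<open>u = 1\<close> by (metis mult.commute power_mult power_one u_def)
qed

lemma two_mem_two_circles_image: "2 \<in> two_circles_image a b"
  unfolding two_circles_image_def by (rule image_eqI[of _ _ 1]) simp_all

section \<open>Symmetries fix the origin\<close>

lemma isometry_fixes_center_of_roots:
  fixes f :: "complex \<Rightarrow> complex"
  assumes f: "\<And>z w. dist (f z) (f w) = dist z w" "f ` two_circles_image a b = two_circles_image a b"
    and ab: "coprime a b" "a < b" "1 < b - a"
  shows "f 0 = 0"
proof -
  define n where "n = b - a"
  define M where "M = {z::complex. z ^ n = 1}"
  have n: "1 < n" using ab by (simp add: n_def)
  have M: "card M = n" "\<Sum>M = 0"
    using n card_roots_unity_eq[of n] sum_roots_unity[of n] by (simp_all add: M_def)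
  have le: "norm (2 * c - f 0) ^ 2 \<le> 4" if "c \<in> M" for c
  proof -
    \<comment> \<open>Surjectivity onto the image matters: the preimage of \<open>2 * c\<close> lies
      within distance 2 of 0, so \<open>2 * c\<close> lies within distance 2 of
      \<open>f 0\<close>.\<close>
    have "2 * c \<in> f ` two_circles_image a b"
      using two_circles_image_root_unity[OF ab(1,2) _ two_mem_two_circles_image, of c] that f(2)
      by (simp add: M_def n_def mult.commute)
    then obtain w where w: "w \<in> two_circles_image a b" "2 * c = f w" by auto
    then have "norm (2 * c - f 0) \<le> 2"
      using f(1)[of w 0] two_circles_image_norm_le[OF w(1)] by (simp add: dist_norm)
    then show ?thesis
      using power_mono[of "norm (2 * c - f 0)" 2 2] by simp
  qed
  have expand: "norm (2 * c - f 0) ^ 2 = 4 + norm (f 0) ^ 2 - 4 * Re (c * cnj (f 0))" if "c \<in> M" for c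
  proof -
    have "norm c = 1"
      using root_unity_norm[of n c] that n by (simp add: M_def)
    then have "(Re c)\<^sup>2 + (Im c)\<^sup>2 = 1"
      using cmod_power2[of c] by simp
    then show ?thesis
      by (simp add: cmod_power2 power2_diff power_mult_distrib algebra_simps)
  qed
  \<comment> \<open>The cross terms cancel, leaving a sum that exceeds the bound
    \<open>4 * n\<close> by \<open>n\<close> times the squared norm of \<open>f 0\<close>.\<close>
  have "(\<Sum>c\<in>M. Re (c * cnj (f 0))) = 0"
    by (simp only: M(2) mult_zero_left complex.sel zero_complex.sel flip: Re_sum sum_distrib_right)
  then have "(\<Sum>c\<in>M. norm (2 * c - f 0) ^ 2) = real n * (4 + norm (f 0) ^ 2)"
    by (simp add: expand sum_subtractf M(1) del: times_complex.sel flip: sum_distrib_left)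
  moreover have "(\<Sum>c\<in>M. norm (2 * c - f 0) ^ 2) \<le> real n * 4"
    using sum_bounded_above[of M "\<lambda>c. norm (2 * c - f 0) ^ 2" 4] le M(1) by simp
  ultimately show ?thesis
    using n by (simp add: algebra_simps mult_le_0_iff)
qed

text \<open>On the circle \<open>w * cnj w\<close> is \<open>2 + z + inverse z\<close>, and
  \<open>w + cnj w\<close> is the sum of \<open>z ^ k + inverse z ^ k\<close> over
  \<open>k = a\<close> and \<open>k = Suc a\<close>; Dickson polynomials express the latter through
  \<open>z + inverse z\<close>.\<close>

lemma two_circles_image_Suc_equation:
  assumes "w \<in> two_circles_image a (Suc a)"
  shows "poly (dickson_poly (Suc a) + dickson_poly a) (w * cnj w - 2) = w + cnj w"
proof -
  from assms obtain z where z: "norm z = 1" "w = z ^ a + z ^ Suc a"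
    by (auto simp: two_circles_image_def)
  then have z0: "z \<noteq> 0" by auto
  have cnj: "cnj z = inverse z"
    using z(1) complex_norm_square[of z] z0 by (simp add: field_simps)
  have za: "z ^ a * inverse z ^ a = 1"
    using z0 by (simp flip: power_mult_distrib)
  have "w * cnj w = (z ^ a * inverse z ^ a) * ((1 + z) * (1 + inverse z))"
    by (simp add: z(2) cnj algebra_simps)
  then have "w * cnj w - 2 = z + inverse z"
    using z0 by (simp add: za algebra_simps)
  moreover have "w + cnj w = (z ^ Suc a + inverse z ^ Suc a) + (z ^ a + inverse z ^ a)"
    by (simp add: z(2) cnj)
  ultimately show ?thesis
    by (simp only: poly_add poly_dickson_poly[OF z0])
qed

text \<open>Substituting the moved point into the equation of the image and clearing denominators
  gives \<open>H = K\<close>. Here \<open>K\<close> vanishes at 0, while \<open>H\<close> takes the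
  value \<open>(d * cnj c) ^ N\<close> there.\<close>

lemma rigid_motion_two_circles_image_Suc:
  assumes a: "0 < a" and c: "norm c = 1"
    and maps: "\<And>w. w \<in> two_circles_image a (Suc a) \<Longrightarrow> c * w + d \<in> two_circles_image a (Suc a)"
  shows "d = 0"
proof -
  define N where "N = Suc a"
  define S where "S = dickson_poly N + dickson_poly a"
  \<comment> \<open>On the circle \<open>P\<close> is the moved point \<open>w\<close>,
    \<open>Q\<close> is \<open>z ^ N * cnj w\<close>, and \<open>A\<close> is
    \<open>z ^ N * (w * cnj w - 2)\<close>.\<close>
  define P where "P = [:d:] + monom c a + monom c N"
  define Q where "Q = [:cnj c, cnj c:] + monom (cnj d) N"
  define A where "A = P * Q - monom 2 N"
  have S: "degree S \<le> N" "coeff S N = 1"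
    using degree_dickson_poly[of N] degree_dickson_poly[of a] coeff_dickson_poly[of a]
    by (auto simp: S_def N_def coeff_eq_0 intro!: degree_add_le)
  obtain H where H: "\<And>z. z \<noteq> 0 \<Longrightarrow> poly H z = z ^ (N * N) * poly S (poly A z / z ^ N)"
    and H0: "poly H 0 = poly A 0 ^ N"
    using clear_denominators[OF S(1), of N A] S(2) by (auto simp: N_def)
  \<comment> \<open>The exponent \<open>N * a\<close> equals \<open>N * N - N\<close>, since
    \<open>Q\<close> already carries a factor \<open>z ^ N\<close>.\<close>
  define K where "K = monom 1 (N * N) * P + monom 1 (N * a) * Q"
  have "H = K"
  proof (rule poly_eq_of_eq_on_unit_circle)
    fix z :: complex assume z: "norm z = 1"
    then have z0: "z \<noteq> 0" by auto
    have cnj: "cnj z = inverse z"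
      using z complex_norm_square[of z] z0 by (simp add: field_simps)
    define w where "w = c * (z ^ a + z ^ Suc a) + d"
    have "w \<in> two_circles_image a (Suc a)"
      unfolding w_def using z by (intro maps) (auto simp: two_circles_image_def)
    then have S_w: "poly S (w * cnj w - 2) = w + cnj w"
      unfolding S_def N_def by (rule two_circles_image_Suc_equation)
    have P: "poly P z = w"
      by (simp add: P_def w_def poly_monom N_def algebra_simps)
    have Q: "poly Q z = z ^ N * cnj w"
      using z0 by (simp add: Q_def w_def poly_monom N_def cnj field_simps)
    have "poly A z / z ^ N = w * cnj w - 2"
      using z0 by (simp add: A_def P Q poly_monom field_simps)
    then have "poly H z = z ^ (N * N) * (w + cnj w)"
      using H[OF z0] S_w by simp
    also have "\<dots> = poly K z"
      by (simp add: K_def P Q poly_monom N_def power_add algebra_simps)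
    finally show "poly H z = poly K z" .
  qed
  moreover have "poly K 0 = 0"
    using a by (simp add: K_def poly_monom N_def)
  ultimately have "poly A 0 = 0"
    using H0 by simp
  moreover have "poly A 0 = d * cnj c"
    using a by (simp add: A_def P_def Q_def poly_monom N_def)
  ultimately show ?thesis
    using c by auto
qed

lemma isometry_two_circles_image_fixes_0:
  fixes f :: "complex \<Rightarrow> complex"
  assumes f: "\<And>z w. dist (f z) (f w) = dist z w" "f ` two_circles_image a b = two_circles_image a b"
    and ab: "0 < a" "coprime a b" "a < b"
  shows "f 0 = 0"
proof (cases "1 < b - a")
  case True
  then show ?thesis
    using isometry_fixes_center_of_roots f ab by blast
next
  case False
  then have b: "b = Suc a" using ab by simp
  have maps: "f w \<in> two_circles_image a b" if "w \<in> two_circles_image a b" for w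
    using f(2) that by blast
  from f(1) show ?thesis
  proof (cases rule: plane_isometry_cases)
    case (1 c)
    show ?thesis
      by (rule rigid_motion_two_circles_image_Suc[OF ab(1) 1(1)]) (metis maps 1(2) b)
  next
    case (2 c)
    \<comment> \<open>Because the image is closed under conjugation, \<open>f\<close> composed with
      \<open>cnj\<close> is a rigid motion mapping the image into itself.\<close>
    show ?thesis
      by (rule rigid_motion_two_circles_image_Suc[OF ab(1) 2(1)])
        (metis maps 2(2) b two_circles_image_cnj complex_cnj_cnj)
  qed
qed

section \<open>The symmetry group and its dihedral form\<close>

lemma unit_motion_in_plane_isometry_group:
  assumes "norm c = 1"
  shows "(\<lambda>z. c * z) \<in> carrier plane_isometry_group"
    "(\<lambda>z. c * cnj z) \<in> carrier plane_isometry_group"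
proof -
  have c: "c \<noteq> 0" using assms by auto
  have d: "dist (c * z) (c * w) = dist z w" for z w
    using assms by (simp add: dist_norm norm_mult flip: right_diff_distrib)
  have d': "dist (cnj z) (cnj w) = dist z w" for z w
    by (simp add: dist_norm flip: complex_cnj_diff)
  have "bij (\<lambda>z. c * z)"
    using c by (intro bij_betw_byWitness[where f' = "\<lambda>z. z / c"]) auto
  then show "(\<lambda>z. c * z) \<in> carrier plane_isometry_group"
    by (simp add: plane_isometry_group_def d)
  have "bij (\<lambda>z. c * cnj z)"
    using c by (intro bij_betw_byWitness[where f' = "\<lambda>z. cnj (z / c)"]) auto
  then show "(\<lambda>z. c * cnj z) \<in> carrier plane_isometry_group"
    by (simp add: plane_isometry_group_def d d')
qed

text \<open>A symmetry fixes 0, so it is determined by a unit factor \<open>c\<close> and an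
  optional conjugation; it sends the real point 2 to \<open>2 * c\<close>, which lies in the image
  only for a root of unity.\<close>

lemma symmetry_group_two_circles_image:
  assumes ab: "0 < a" "coprime a b" "a < b"
  shows "symmetry_group (two_circles_image a b) =
    (\<lambda>c z. c * z) ` {c. c ^ (b - a) = 1} \<union> (\<lambda>c z. c * cnj z) ` {c. c ^ (b - a) = 1}"
    (is "symmetry_group ?X = ?R \<union> ?S")
proof (intro equalityI subsetI)
  fix f assume "f \<in> symmetry_group ?X"
  then have iso: "dist (f z) (f w) = dist z w" and fX: "f ` ?X = ?X" for z w
    by (auto simp: symmetry_group_def plane_isometry_group_def)
  have f0: "f 0 = 0"
    using isometry_two_circles_image_fixes_0[OF iso fX ab] .
  have f2: "f 2 \<in> ?X"
    using fX two_mem_two_circles_image by blast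
  from iso show "f \<in> ?R \<union> ?S"
  proof (cases rule: plane_isometry_cases)
    case (1 c)
    then have "2 * c \<in> ?X" using f2 f0 by (metis add.right_neutral mult.commute)
    then have "c ^ (b - a) = 1"
      using two_circles_image_double_unit ab 1 by blast
    moreover have "f = (\<lambda>z. c * z)" using 1(2) f0 by auto
    ultimately show ?thesis by blast
  next
    case (2 c)
    then have "2 * c \<in> ?X"
      using f2 f0 by (metis add.right_neutral mult.commute complex_cnj_numeral)
    then have "c ^ (b - a) = 1"
      using two_circles_image_double_unit ab 2 by blast
    moreover have "f = (\<lambda>z. c * cnj z)" using 2(2) f0 by auto
    ultimately show ?thesis by blast
  qed
next
  fix f assume "f \<in> ?R \<union> ?S"
  then obtain c where c: "c ^ (b - a) = 1" and f: "f = (\<lambda>z. c * z) \<or> f = (\<lambda>z. c * cnj z)"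
    by blast
  have nc: "norm c = 1"
    using root_unity_norm[of "b - a" c] c ab by simp
  then have c0: "c \<noteq> 0" by auto
  have maps: "f w \<in> ?X" if "w \<in> ?X" for w
    using f two_circles_image_root_unity[OF ab(2,3) c] two_circles_image_cnj that by auto
  \<comment> \<open>The inverse root supplies the preimages for surjectivity.\<close>
  have inv: "inverse c * w \<in> ?X" if "w \<in> ?X" for w
    using two_circles_image_root_unity[OF ab(2,3) _ that] c by (simp add: power_inverse)
  have "w \<in> f ` ?X" if "w \<in> ?X" for w
    using f
  proof
    assume "f = (\<lambda>z. c * z)"
    then have "w = f (inverse c * w)" using c0 by simp
    then show ?thesis using inv[OF that] by blast
  next
    assume "f = (\<lambda>z. c * cnj z)"
    then have "w = f (cnj (inverse c * w))" using c0 by simp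
    then show ?thesis using two_circles_image_cnj[OF inv[OF that]] by blast
  qed
  with maps have "f ` ?X = ?X" by blast
  then show "f \<in> symmetry_group ?X"
    using f unit_motion_in_plane_isometry_group[OF nc] by (auto simp: symmetry_group_def)
qed

lemma card_dihedral_functions:
  fixes M :: "complex set"
  assumes "finite M" "0 \<notin> M"
  shows "card ((\<lambda>c z. c * z) ` M \<union> (\<lambda>c z. c * cnj z) ` M) = 2 * card M"
proof -
  have 1: "inj_on (\<lambda>c z. c * z) M" and 2: "inj_on (\<lambda>c z. c * cnj z) M"
    by (auto intro!: inj_onI dest: fun_cong[where x = 1])
  have "(\<lambda>z. c * z) \<noteq> (\<lambda>z. d * cnj z)" if "c \<in> M" for c d
  proof
    assume eq: "(\<lambda>z. c * z) = (\<lambda>z. d * cnj z)"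
    \<comment> \<open>Evaluation at 1 and at the imaginary unit, whose conjugation changes the
      sign.\<close>
    have "c = d" "c = - d"
      using fun_cong[OF eq, of 1] fun_cong[OF eq, of \<i>] by (simp_all add: complex_eq_iff)
    with that assms show False by auto
  qed
  then have "(\<lambda>c z. c * z) ` M \<inter> (\<lambda>c z. c * cnj z) ` M = {}" by blast
  then show ?thesis
    using assms(1) by (simp add: card_Un_disjoint card_image 1 2)
qed

lemma is_dihedral_roots_unity:
  assumes n: "0 < n" and D: "subgroup D plane_isometry_group"
    and D_eq: "D = (\<lambda>c z. c * z) ` {c. c ^ n = 1} \<union> (\<lambda>c z. c * cnj z) ` {c. c ^ n = 1}"
  shows "is_dihedral n D"
proof -
  define M where "M = {c::complex. c ^ n = 1}"
  have M: "finite M" "0 \<notin> M" "card M = n"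
    using n card_roots_unity_eq[of n] finite_roots_unity[of n]
    by (auto simp: M_def power_0_left)
  have M_eq: "M = (\<lambda>k. cis (2 * pi * real k / real n)) ` {..<n}"
    using Complex.bij_betw_roots_unity[OF n] by (simp add: bij_betw_def M_def)
  have "card D = 2 * n"
    unfolding D_eq using card_dihedral_functions[OF M(1,2)] M(3) by (simp add: M_def)
  \<comment> \<open>A reflection has factor \<open>cis (2 * \<phi>)\<close>, so the axis angles are
    half the arguments of the roots of unity.\<close>
  moreover define \<Phi> where "\<Phi> = (\<lambda>k. pi * real k / real n) ` {..<n}"
  have "\<Phi> \<subseteq> {0..<pi}" "finite \<Phi>" "card \<Phi> = n"
    using n by (auto simp: \<Phi>_def field_simps card_image inj_on_def)
  moreover have "(\<lambda>c z. c * cnj z) ` M = reflection_about 0 ` \<Phi>"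
    unfolding M_eq \<Phi>_def image_image
    by (intro image_cong) (auto simp: reflection_about_def fun_eq_iff mult.assoc)
  moreover have "(\<lambda>c z. c * z) ` M = {rotation_about 0 (of_int k * (2 * pi / real n)) |k :: int. True}"
  proof (intro equalityI subsetI)
    fix f assume "f \<in> (\<lambda>c z. c * z) ` M"
    then obtain k where "f = (\<lambda>z. cis (2 * pi * real k / real n) * z)"
      unfolding M_eq by auto
    then have "f = rotation_about 0 (of_int (int k) * (2 * pi / real n))"
      by (simp add: rotation_about_def fun_eq_iff mult_ac)
    then show "f \<in> {rotation_about 0 (of_int k * (2 * pi / real n)) |k :: int. True}" by blast
  next
    fix f assume "f \<in> {rotation_about 0 (of_int k * (2 * pi / real n)) |k :: int. True}"
    then obtain k :: int where k: "f = rotation_about 0 (of_int k * (2 * pi / real n))" by blast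
    define c where "c = cis (of_int k * (2 * pi / real n))"
    have "c ^ n = cis (2 * pi * of_int k)"
      using n by (simp add: c_def Complex.DeMoivre field_simps)
    then have "c \<in> M" by (simp add: M_def)
    moreover have "f = (\<lambda>z. c * z)"
      by (simp add: k c_def rotation_about_def fun_eq_iff)
    ultimately show "f \<in> (\<lambda>c z. c * z) ` M" by blast
  qed
  ultimately show ?thesis
    unfolding is_dihedral_def using n D D_eq by (auto simp: M_def intro!: exI[of _ 0] exI[of _ \<Phi>])
qed

theorem corollary1:
  fixes a b :: nat
  assumes "0 < a" and "0 < b" and "coprime a b" and "b > a"
  shows "(a = 1 \<longrightarrow> is_dihedral (b - 1) (symmetry_group (\<gamma> a b ` {0..1}))) \<and>
         (a \<noteq> 1 \<longrightarrow> is_dihedral (b - a) (symmetry_group (\<gamma> a b ` {0..1})))"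
proof -
  \<comment> \<open>For \<open>a = 1\<close> the order \<open>b - 1\<close> is \<open>b - a\<close>,
    so one claim covers both conjuncts.\<close>
  have "is_dihedral (b - a) (symmetry_group (\<gamma> a b ` {0..1}))"
    unfolding image_two_circles_curve
    using assms by (intro is_dihedral_roots_unity symmetry_group_two_circles_image
        subgroup_symmetry_group) simp_all
  then show ?thesis by auto
qed

end
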